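(* The matrix elements of the twist element $\mathcal F$ are $$F^{j_1,j_2}_{k_1,k_2;\,m_1,m_2}=\delta_{k_1,m_1}\,\theta(m_2\le k_2\le j_2)\,S^{j_2}_{k_2,m_2}\times G,$$ where, for $m_1\le0$, $$G=\frac{(2k_2-2m_1-2m_2-2)!!}{(k_2-m_2)!\,(-2m_1-2)!!}\,h^{k_2-m_2},$$ and, for $m_1>0$, $$G=(-2h)^{k_2-m_2}\sum_{\ell=0}^{j_2-m_2}(-1)^\ell\binom{2m_1}{k_2-m_2-\ell}\frac{(2\ell+2m_1-2)!!}{2^\ell\,\ell!\,(2m_1-2)!!},$$ with $$S^{j_2}_{k_2,m_2}=\left\{\frac{(j_2-m_2)!\,(j_2+k_2)!}{(j_2+m_2)!\,(j_2-k_2)!}\right\}^{1/2}.$$ Here $n!!=1$ for $n\le0$, and $\theta(m_2\le k_2\le j_2)=1$ if the inequality in parentheses holds and $0$ otherwise.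
   Context: $\mathcal F=\exp(-\tfrac12J_0\otimes\sigma)$ with $\sigma=-\ln(1-2hJ_+)$ is the twist element of the Jordanian quantum algebra $\mathcal U_h(sl(2))$ with deformation parameter $h$, whose generators satisfy $[J_0,J_\pm]=\pm2J_\pm$, $[J_+,J_-]=J_0$. The spin-$j$ irreducible representation, $j\in\{0,\tfrac12,1,\dots\}$, has orthonormal basis $|j\,m\rangle$, $m\in\{-j,\dots,j\}$, with $J_\pm|j\,m\rangle=\sqrt{(j\mp m)(j\pm m+1)}\,|j\,m\pm1\rangle$, $J_0|j\,m\rangle=2m|j\,m\rangle$. The matrix elements are $$F^{j_1,j_2}_{k_1,k_2;\,m_1,m_2}=\langle j_1k_1|\otimes\langle j_2k_2|\,\mathcal F\,|j_1m_1\rangle\otimes|j_2m_2\rangle,$$ with $k_1,m_1\in\{-j_1,\dots,j_1\}$ and $k_2,m_2\in\{-j_2,\dots,j_2\}$. For $n>0$, $n!!=n(n-2)(n-4)\cdots$ is the usual double factorial (ending in $1$ or $2$). Binomial coefficients $\binom{n}{r}$ vanish for $r<0$ or $r>n$.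
   Formalization: For m_1=0 and k_2>m_2 the printed G is wrong (j_1=0, j_2=k_2=1/2, m_2=-1/2 gives h, but F is the identity there, so the element is 0); in that case the value 0 is proved instead, and the printed formula is proved in all other cases. *)

theory Defs
  imports Complex_Main "Jordan_Normal_Form.Matrix"
begin

(* Spins j and weights m are kept as real half-integers; floor is only ever applied to
   expressions that are integers for admissible arguments. *)

definition spins :: "real set" where
  "spins = {j. \<exists>n::nat. j = real n / 2}"

definition weights :: "real \<Rightarrow> real set" where
  "weights j = {m. - j \<le> m \<and> m \<le> j \<and> j - m \<in> \<int>}"

(* The basis vector |j m> is the coordinate vector number j - m, i.e. the basis is ordered
   m = j, j - 1, ..., - j. *)

definition spin_dim :: "real \<Rightarrow> nat" where
  "spin_dim j = nat \<lfloor>2 * j + 1\<rfloor>"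

definition spin_idx :: "real \<Rightarrow> real \<Rightarrow> nat" where
  "spin_idx j m = nat \<lfloor>j - m\<rfloor>"

(* The operator a with <j k| a |j m> = f k m. *)
definition spin_mat :: "real \<Rightarrow> (real \<Rightarrow> real \<Rightarrow> complex) \<Rightarrow> complex mat" where
  "spin_mat j f = mat (spin_dim j) (spin_dim j) (\<lambda>(r, c). f (j - real r) (j - real c))"

definition J_plus :: "real \<Rightarrow> complex mat" where
  "J_plus j = spin_mat j (\<lambda>k m. if k = m + 1
     then complex_of_real (sqrt ((j - m) * (j + m + 1))) else 0)"

definition J_zero :: "real \<Rightarrow> complex mat" where
  "J_zero j = spin_mat j (\<lambda>k m. if k = m then complex_of_real (2 * m) else 0)"

(* |j1 m1> tensor |j2 m2> is numbered as by tensor_idx. *)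
definition tensor_mat :: "complex mat \<Rightarrow> complex mat \<Rightarrow> complex mat" where
  "tensor_mat A B = mat (dim_row A * dim_row B) (dim_col A * dim_col B)
     (\<lambda>(r, c). A $$ (r div dim_row B, c div dim_col B) * B $$ (r mod dim_row B, c mod dim_col B))"

definition tensor_idx :: "real \<Rightarrow> real \<Rightarrow> real \<Rightarrow> real \<Rightarrow> nat" where
  "tensor_idx j1 j2 m1 m2 = spin_idx j1 m1 * spin_dim j2 + spin_idx j2 m2"

(* Entrywise sum of a power series in a square matrix. Below it is only applied to nilpotent
   matrices, so that all sums are finite: J_plus is strictly upper triangular, hence so is
   sigma, and sigma appears as a tensor factor under the exponential. *)
definition mat_series :: "(nat \<Rightarrow> complex) \<Rightarrow> complex mat \<Rightarrow> complex mat" where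
  "mat_series c A = mat (dim_row A) (dim_row A) (\<lambda>(i, k). \<Sum>n. c n * (A ^\<^sub>m n) $$ (i, k))"

definition mat_exp :: "complex mat \<Rightarrow> complex mat" where
  "mat_exp A = mat_series (\<lambda>n. 1 / fact n) A"

(* Logarithm series around the identity matrix. *)
definition mat_ln :: "complex mat \<Rightarrow> complex mat" where
  "mat_ln A = mat_series (\<lambda>n. if n = 0 then 0 else (-1) ^ (n + 1) / of_nat n)
     (A - 1\<^sub>m (dim_row A))"

definition sigma :: "complex \<Rightarrow> real \<Rightarrow> complex mat" where
  "sigma h j = - mat_ln (1\<^sub>m (spin_dim j) - (2 * h) \<cdot>\<^sub>m J_plus j)"

definition twist :: "complex \<Rightarrow> real \<Rightarrow> real \<Rightarrow> complex mat" where
  "twist h j1 j2 = mat_exp ((- 1 / 2) \<cdot>\<^sub>m tensor_mat (J_zero j1) (sigma h j2))"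

definition twist_elem ::
  "complex \<Rightarrow> real \<Rightarrow> real \<Rightarrow> real \<Rightarrow> real \<Rightarrow> real \<Rightarrow> real \<Rightarrow> complex" where
  "twist_elem h j1 j2 k1 k2 m1 m2 =
     twist h j1 j2 $$ (tensor_idx j1 j2 k1 k2, tensor_idx j1 j2 m1 m2)"

function double_fact :: "int \<Rightarrow> int" where
  "double_fact n = (if n \<le> 0 then 1 else n * double_fact (n - 2))"
  by auto
termination by (relation "measure nat") auto

declare double_fact.simps [simp del]

(* n!! and n! for an integer n that is given as a real number *)
abbreviation dfact :: "real \<Rightarrow> complex" where
  "dfact x \<equiv> of_int (double_fact \<lfloor>x\<rfloor>)"

abbreviation rfact :: "real \<Rightarrow> real" where
  "rfact x \<equiv> fact (nat \<lfloor>x\<rfloor>)"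

definition binom :: "int \<Rightarrow> int \<Rightarrow> complex" where
  "binom n r = (if r < 0 \<or> n < r then 0 else of_nat (nat n choose nat r))"

definition theta :: "bool \<Rightarrow> complex" where
  "theta P = (if P then 1 else 0)"

definition S_coeff :: "real \<Rightarrow> real \<Rightarrow> real \<Rightarrow> real" where
  "S_coeff j k m =
     sqrt ((rfact (j - m) * rfact (j + k)) / (rfact (j + m) * rfact (j - k)))"

(* For k2 < m2 the value is irrelevant (theta vanishes).
   Pitfall: for m1 = 0 and m2 < k2 the value is not 0, whereas the matrix element is: the twist
   is (1 - 2 h J_plus)^m1 on the m1 weight space, i.e. the identity for m1 = 0. With
   n = k2 - m2, the ratio (2 n - 2 m1 - 2)!! / (- 2 m1 - 2)!! represents the rising product
   (- 2 m1) (- 2 m1 + 2) ... (- 2 m1 + 2 n - 2), and fails to do so exactly in this case,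
   because of the convention (-2)!! = 1. *)
definition G_coeff :: "complex \<Rightarrow> real \<Rightarrow> real \<Rightarrow> real \<Rightarrow> real \<Rightarrow> complex" where
  "G_coeff h j2 m1 k2 m2 =
     (if m1 \<le> 0 then
        dfact (2 * k2 - 2 * m1 - 2 * m2 - 2)
          / (complex_of_real (rfact (k2 - m2)) * dfact (- 2 * m1 - 2)) * h ^ nat \<lfloor>k2 - m2\<rfloor>
      else
        (- 2 * h) ^ nat \<lfloor>k2 - m2\<rfloor> *
        (\<Sum>l = 0..nat \<lfloor>j2 - m2\<rfloor>.
           (- 1) ^ l * binom \<lfloor>2 * m1\<rfloor> (\<lfloor>k2 - m2\<rfloor> - int l)
             * dfact (2 * real l + 2 * m1 - 2) / (2 ^ l * fact l * dfact (2 * m1 - 2))))"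

end

(* On the weight space J_0 = 2 m_1 the twist acts as exp (- m_1 sigma) = (1 - 2 h J_+)^{m_1}.
   A power series in a J_+ has entries f_n a^n <k|J_+^n|m>, n = k - m, and <k|J_+^n|m> is a quotient
   of weights w(m) / w(k); so sums, products and compositions of such matrices are those of the
   formal power series f, and the matrix elements of the twist are binomial coefficients of m_1
   over n. For m_1 < 0 these are quotients of double factorials; for m_1 > 0 the sum over l is
   Vandermonde's convolution for (1 + X)^{m_1} = (1 + X)^{2 m_1} (1 + X)^{- m_1}. *)

theory Submission
  imports Defs "HOL-Computational_Algebra.Formal_Power_Series"
begin

section \<open>Power series and their weighted Toeplitz matrices\<close>

text \<open>Formally exp (a ln (1 + X)) = (1 + X)^a: the composite has constant term 1 and satisfies
  (1 + X) f' = a f, which characterizes the binomial series.\<close>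

lemma fps_exp_compose_neg_ln:
  fixes a :: "'a :: field_char_0"
  shows "fps_exp (- a) oo (- fps_ln 1) = fps_binomial a"
proof -
  let ?f = "fps_exp (- a) oo (- fps_ln 1)"
  have unit: "fps_nth (1 + fps_X :: 'a fps) 0 \<noteq> 0" by simp
  have "fps_deriv ?f = ((fps_const (- a) * fps_exp (- a)) oo (- fps_ln 1)) * fps_deriv (- fps_ln 1)"
    by (subst fps_compose_deriv) simp_all
  also have "\<dots> = fps_const (- a) * ?f * (- inverse (1 + fps_X))"
    by (simp add: fps_compose_mult_distrib fps_ln_deriv)
  also have "\<dots> = fps_const a * ?f / (1 + fps_X)"
    by (simp add: fps_divide_unit[OF unit] flip: fps_const_neg)
  finally show ?thesis
    by (simp flip: fps_binomial_ODE_unique')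
qed

(* The image of the power series f under X |-> a J_+: with w = spin_weight N and
   f = X this is a J_+ for spin N/2. The power of a is not absorbed in w, since w must not vanish. *)
definition weighted_toeplitz :: "nat \<Rightarrow> complex \<Rightarrow> (nat \<Rightarrow> complex) \<Rightarrow> complex fps \<Rightarrow> complex mat" where
  "weighted_toeplitz d a w f = mat d d
     (\<lambda>(r, c). if r \<le> c then fps_nth f (c - r) * a ^ (c - r) * w c / w r else 0)"

lemma weighted_toeplitz_carrier [simp]: "weighted_toeplitz d a w f \<in> carrier_mat d d"
  and weighted_toeplitz_dim [simp]: "dim_row (weighted_toeplitz d a w f) = d"
    "dim_col (weighted_toeplitz d a w f) = d"
  by (simp_all add: weighted_toeplitz_def)

lemma weighted_toeplitz_index:
  "r < d \<Longrightarrow> c < d \<Longrightarrow> weighted_toeplitz d a w f $$ (r, c) =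
     (if r \<le> c then fps_nth f (c - r) * a ^ (c - r) * w c / w r else 0)"
  by (simp add: weighted_toeplitz_def)

lemma weighted_toeplitz_one:
  assumes "\<And>i. i < d \<Longrightarrow> w i \<noteq> 0"
  shows "weighted_toeplitz d a w 1 = 1\<^sub>m d"
  by (rule eq_matI) (auto simp: weighted_toeplitz_index assms)

lemma weighted_toeplitz_uminus:
  "weighted_toeplitz d a w (- f) = - weighted_toeplitz d a w f"
  by (rule eq_matI) (auto simp: weighted_toeplitz_index)

text \<open>The weights telescope, (w e / w r) (w c / w e) = w c / w r, and the powers of
  \<open>a\<close> add up; only r \<le> e \<le> c contributes, which leaves the Cauchy
  product.\<close>

lemma weighted_toeplitz_mult:
  assumes w: "\<And>i. i < d \<Longrightarrow> w i \<noteq> 0"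
  shows "weighted_toeplitz d a w f * weighted_toeplitz d a w g = weighted_toeplitz d a w (f * g)"
proof (rule eq_matI)
  fix r c assume "r < dim_row (weighted_toeplitz d a w (f * g))"
    and "c < dim_col (weighted_toeplitz d a w (f * g))"
  hence rc: "r < d" "c < d" by simp_all
  let ?F = "weighted_toeplitz d a w f" and ?G = "weighted_toeplitz d a w g"
  have "(?F * ?G) $$ (r, c) = (\<Sum>e<d. ?F $$ (r, e) * ?G $$ (e, c))"
    using rc by (simp add: scalar_prod_def lessThan_atLeast0)
  also have "\<dots> = (\<Sum>e\<in>{r..c}. ?F $$ (r, e) * ?G $$ (e, c))"
    using rc by (intro sum.mono_neutral_right) (auto simp: weighted_toeplitz_index)
  also have "\<dots> = (\<Sum>e\<in>{r..c}.
      fps_nth f (e - r) * fps_nth g (c - e) * (a ^ (c - r) * w c / w r))"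
  proof (rule sum.cong[OF refl])
    fix e assume e: "e \<in> {r..c}"
    hence "a ^ (c - r) = a ^ (e - r) * a ^ (c - e)"
      by (simp flip: power_add)
    thus "?F $$ (r, e) * ?G $$ (e, c) =
        fps_nth f (e - r) * fps_nth g (c - e) * (a ^ (c - r) * w c / w r)"
      using e rc w[of e] by (simp add: weighted_toeplitz_index)
  qed
  also have "\<dots> = weighted_toeplitz d a w (f * g) $$ (r, c)"
  proof (cases "r \<le> c")
    case True
    have "(\<Sum>e\<in>{r..c}. fps_nth f (e - r) * fps_nth g (c - e))
        = (\<Sum>i=0..c-r. fps_nth f i * fps_nth g (c - r - i))"
      by (rule sum.reindex_bij_witness[of _ "\<lambda>i. i + r" "\<lambda>e. e - r"]) (use True in auto)
    thus ?thesis
      unfolding sum_distrib_right[symmetric] using rc True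
      by (simp add: weighted_toeplitz_index fps_mult_nth)
  qed (use rc in \<open>simp add: weighted_toeplitz_index\<close>)
  finally show "(?F * ?G) $$ (r, c) = weighted_toeplitz d a w (f * g) $$ (r, c)" .
qed simp_all

lemma weighted_toeplitz_power:
  assumes "\<And>i. i < d \<Longrightarrow> w i \<noteq> 0"
  shows "weighted_toeplitz d a w f ^\<^sub>m n = weighted_toeplitz d a w (f ^ n)"
  by (induction n)
     (simp_all add: weighted_toeplitz_one weighted_toeplitz_mult assms power_commutes)

text \<open>Without a constant term in \<open>f\<close>, the power f^n has no terms below X^n, so
  only n \<le> k contributes.\<close>

lemma suminf_fps_compose_nth:
  fixes c :: "nat \<Rightarrow> complex"
  assumes "fps_nth f 0 = 0"
  shows "(\<Sum>n. c n * fps_nth (f ^ n) k) = fps_nth (Abs_fps c oo f) k"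
proof -
  have "(\<Sum>n. c n * fps_nth (f ^ n) k) = (\<Sum>n\<in>{0..k}. c n * fps_nth (f ^ n) k)"
    by (rule suminf_finite) (simp_all add: startsby_zero_power_prefix[OF assms, rule_format])
  thus ?thesis by (simp add: fps_compose_nth)
qed

lemma suminf_weighted_toeplitz:
  assumes "fps_nth f 0 = 0" "r < d" "c < d"
  shows "(\<Sum>n. b n * weighted_toeplitz d a w (f ^ n) $$ (r, c)) =
    weighted_toeplitz d a w (Abs_fps b oo f) $$ (r, c)"
proof (cases "r \<le> c")
  case True
  let ?t = "a ^ (c - r) * w c / w r"
  have "(\<Sum>n. b n * weighted_toeplitz d a w (f ^ n) $$ (r, c)) =
      (\<Sum>n. b n * fps_nth (f ^ n) (c - r) * ?t)"
    using True assms by (simp add: weighted_toeplitz_index mult.assoc)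
  \<comment> \<open>The terms with n > c - r vanish, which gives the summability needed to pull out
    the constant.\<close>
  also have "\<dots> = (\<Sum>n. b n * fps_nth (f ^ n) (c - r)) * ?t"
    by (rule suminf_mult2[symmetric], rule summable_finite[of "{..c - r}"])
       (simp_all add: startsby_zero_power_prefix[OF assms(1), rule_format])
  finally show ?thesis
    using True assms by (simp add: weighted_toeplitz_index suminf_fps_compose_nth)
qed (use assms in \<open>simp add: weighted_toeplitz_index\<close>)

text \<open>Serves the logarithm. The exponential is taken of a tensor product and uses the
  entrywise version above.\<close>

lemma mat_series_weighted_toeplitz:
  assumes "\<And>i. i < d \<Longrightarrow> w i \<noteq> 0" "fps_nth f 0 = 0"
  shows "mat_series b (weighted_toeplitz d a w f) = weighted_toeplitz d a w (Abs_fps b oo f)"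
  by (rule eq_matI)
     (simp_all add: mat_series_def weighted_toeplitz_power suminf_weighted_toeplitz assms)

section \<open>Tensor products with a diagonal factor\<close>

lemma sum_blocks:
  fixes f :: "nat \<Rightarrow> 'a :: comm_monoid_add"
  shows "(\<Sum>e<d1 * d2. f e) = (\<Sum>m<d1. \<Sum>u<d2. f (m * d2 + u))"
proof -
  have "(\<Sum>e\<in>{m * d2..<m * d2 + d2}. f e) = (\<Sum>u<d2. f (m * d2 + u))" for m
    by (rule sum.reindex_bij_witness[of _ "\<lambda>u. m * d2 + u" "\<lambda>e. e - m * d2"]) auto
  thus ?thesis by (simp flip: sum.nat_group)
qed

lemma block_index_less:
  assumes "i < d1" "p < d2"
  shows "i * d2 + p < d1 * (d2 :: nat)"
proof -
  have "i * d2 + p < Suc i * d2" using assms(2) by simp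
  also have "\<dots> \<le> d1 * d2" using assms(1) by (intro mult_le_mono1) simp
  finally show ?thesis .
qed

text \<open>A diagonal first factor preserves each block of second-factor indices and acts on it as
  a scalar, so on block \<open>i\<close> the matrix is (s g_i) B.\<close>

lemma tensor_diag_pow_index:
  assumes B: "B \<in> carrier_mat d2 d2" and "i < d1" "k < d1" "p < d2" "q < d2"
  shows "((s \<cdot>\<^sub>m tensor_mat (mat_diag d1 g) B) ^\<^sub>m n) $$ (i * d2 + p, k * d2 + q) =
    (if i = k then (s * g i) ^ n * (B ^\<^sub>m n) $$ (p, q) else 0)"
  using assms(3,5)
\<comment> \<open>The last factor is split off on the right, so the induction hypothesis is needed
  at every column.\<close>
proof (induction n arbitrary: k q)
  case 0
  have "i * d2 + p = k * d2 + q \<longleftrightarrow> i = k \<and> p = q"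
    using assms(4) 0 by (metis add_left_cancel div_mult_self3 div_less add.right_neutral
        less_nat_zero_code add.commute)
  then show ?case
    using assms 0 by (auto simp: tensor_mat_def mat_diag_def block_index_less)
next
  case (Suc n)
  let ?A = "s \<cdot>\<^sub>m tensor_mat (mat_diag d1 g) B"
  have dims: "dim_row ?A = d1 * d2" "dim_col ?A = d1 * d2"
    using B by (simp_all add: tensor_mat_def mat_diag_def)
  have entry: "?A $$ (m * d2 + u, k * d2 + q) = (if m = k then s * g k * B $$ (u, q) else 0)"
    if "m < d1" "u < d2" for m u
    using that Suc.prems B by (simp add: tensor_mat_def mat_diag_def block_index_less)
  have "(?A ^\<^sub>m Suc n) $$ (i * d2 + p, k * d2 + q) =
      (\<Sum>e<d1 * d2. (?A ^\<^sub>m n) $$ (i * d2 + p, e) * ?A $$ (e, k * d2 + q))"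
    using assms(2,4) Suc.prems dims
    by (simp add: scalar_prod_def lessThan_atLeast0 block_index_less del: index_smult_mat)
  also have "\<dots> = (\<Sum>m<d1. \<Sum>u<d2. (if i = m then (s * g i) ^ n * (B ^\<^sub>m n) $$ (p, u) else 0) *
      (if m = k then s * g k * B $$ (u, q) else 0))"
    unfolding sum_blocks by (intro sum.cong refl) (simp add: Suc.IH entry)
  also have "\<dots> = (\<Sum>m<d1. if m = k then
      (\<Sum>u<d2. if i = k then (s * g k) ^ Suc n * ((B ^\<^sub>m n) $$ (p, u) * B $$ (u, q)) else 0) else 0)"
    by (intro sum.cong refl) (auto simp: mult_ac intro!: sum.cong)
  also have "\<dots> = (if i = k then (s * g k) ^ Suc n * (\<Sum>u<d2. (B ^\<^sub>m n) $$ (p, u) * B $$ (u, q)) else 0)"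
    using Suc.prems by (simp add: sum_distrib_left)
  also have "(\<Sum>u<d2. (B ^\<^sub>m n) $$ (p, u) * B $$ (u, q)) = (B ^\<^sub>m Suc n) $$ (p, q)"
    using assms Suc.prems by (simp add: scalar_prod_def lessThan_atLeast0)
  finally show ?case by auto
qed

section \<open>Spin representations and matrix elements of the twist\<close>

text \<open>With N = 2 j and i = j - m this is the square root of (j - m)! / (j + m)!, chosen so
  that for i < N the ratio w (i + 1) / w i = sqrt ((i + 1) (N - i)) is a matrix element of
  J_+.\<close>

definition spin_weight :: "nat \<Rightarrow> nat \<Rightarrow> complex" where
  "spin_weight N i = complex_of_real (sqrt (fact i / fact (N - i)))"

lemma spin_weight_nonzero [simp]: "spin_weight N i \<noteq> 0"
  by (simp add: spin_weight_def)

lemma spin_dim_half [simp]: "spin_dim (real N / 2) = Suc N"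
  by (simp add: spin_dim_def nat_add_distrib)

lemma spin_idx_half [simp]: "spin_idx j (j - real i) = i"
  by (simp add: spin_idx_def)

lemma smult_J_plus_eq_weighted_toeplitz:
  "a \<cdot>\<^sub>m J_plus (real N / 2) = weighted_toeplitz (Suc N) a (spin_weight N) fps_X"
proof (rule eq_matI)
  fix r c assume "r < dim_row (weighted_toeplitz (Suc N) a (spin_weight N) fps_X)"
    "c < dim_col (weighted_toeplitz (Suc N) a (spin_weight N) fps_X)"
  hence rc: "r < Suc N" "c < Suc N" by simp_all
  show "(a \<cdot>\<^sub>m J_plus (real N / 2)) $$ (r, c) =
      weighted_toeplitz (Suc N) a (spin_weight N) fps_X $$ (r, c)"
  proof (cases "c = Suc r")
    case True
    \<comment> \<open>With c = r + 1 the quotients c! / r! and (N - r)! / (N - c)! reduce to c and N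
      - r.\<close>
    hence "N - r = Suc (N - c)"
      using rc by simp
    hence "real c * real (N - r) = (fact c / fact (N - c)) / (fact r / fact (N - r))"
      using True by (simp add: field_simps)
    hence "sqrt (real c * real (N - r)) = sqrt (fact c / fact (N - c)) / sqrt (fact r / fact (N - r))"
      by (simp only: real_sqrt_divide)
    moreover have "(real N / 2 - (real N / 2 - real c)) * (real N / 2 + (real N / 2 - real c) + 1)
        = real c * real (N - r)"
      using rc True by (simp add: of_nat_diff)
    ultimately show ?thesis
      using rc True unfolding J_plus_def spin_mat_def
      by (simp add: weighted_toeplitz_index spin_weight_def)
  next
    case False
    hence "real N / 2 - real r \<noteq> real N / 2 - real c + 1"
      by linarith
    thus ?thesis
      using rc False by (auto simp: J_plus_def spin_mat_def weighted_toeplitz_index fps_X_def)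
  qed
qed (simp_all add: J_plus_def spin_mat_def)

text \<open>The argument of the logarithm differs from the identity by - 2 h J_+, so
  \<open>mat_ln\<close> is ln (1 + X) at X = - 2 h J_+.\<close>

lemma sigma_eq_weighted_toeplitz:
  "sigma h (real N / 2) = weighted_toeplitz (Suc N) (- 2 * h) (spin_weight N) (- fps_ln 1)"
proof -
  have car: "J_plus (real N / 2) \<in> carrier_mat (Suc N) (Suc N)"
    by (simp add: J_plus_def spin_mat_def)
  have "1\<^sub>m (Suc N) - (2 * h) \<cdot>\<^sub>m J_plus (real N / 2) - 1\<^sub>m (Suc N) = (- 2 * h) \<cdot>\<^sub>m J_plus (real N / 2)"
    by (rule eq_matI) (use car in auto)
  moreover have "Abs_fps (\<lambda>n. if n = 0 then 0 else (-1) ^ (n + 1) / of_nat n) oo fps_X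
      = (fps_ln 1 :: complex fps)"
    by (auto simp: fps_eq_iff fps_ln_nth gr0_conv_Suc)
  ultimately show ?thesis
    using car by (simp add: sigma_def mat_ln_def smult_J_plus_eq_weighted_toeplitz
      mat_series_weighted_toeplitz weighted_toeplitz_uminus del: One_nat_def)
qed

text \<open>The factor - 1/2 turns the eigenvalue 2 m of J_0 into - m, so on that block the twist is
  (1 + X)^m at X = - 2 h J_+.\<close>

lemma twist_elem_gbinomial:
  assumes "i < Suc N1" "k < Suc N1" "p < Suc N" "q < Suc N"
  shows "twist_elem h (real N1 / 2) (real N / 2) (real N1 / 2 - real i) (real N / 2 - real p)
      (real N1 / 2 - real k) (real N / 2 - real q) =
    (if i = k \<and> p \<le> q then (complex_of_real (real N1 / 2 - real k) gchoose (q - p)) *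
       (- 2 * h) ^ (q - p) * spin_weight N q / spin_weight N p else 0)"
proof -
  let ?B = "sigma h (real N / 2)" and ?m = "complex_of_real (real N1 / 2 - real k)"
  let ?g = "\<lambda>c. complex_of_real (2 * (real N1 / 2 - real c))"
  let ?A = "(- 1 / 2) \<cdot>\<^sub>m tensor_mat (mat_diag (Suc N1) ?g) ?B"
  have B: "?B \<in> carrier_mat (Suc N) (Suc N)"
    by (simp add: sigma_eq_weighted_toeplitz)
  have J0: "J_zero (real N1 / 2) = mat_diag (Suc N1) ?g"
    by (rule eq_matI) (auto simp: J_zero_def spin_mat_def mat_diag_def)
  have dims: "dim_row ?A = Suc N1 * Suc N"
    using B by (simp add: tensor_mat_def mat_diag_def)
  have "twist_elem h (real N1 / 2) (real N / 2) (real N1 / 2 - real i) (real N / 2 - real p)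
      (real N1 / 2 - real k) (real N / 2 - real q) =
      (\<Sum>n. 1 / fact n * (?A ^\<^sub>m n) $$ (i * Suc N + p, k * Suc N + q))"
    unfolding twist_elem_def twist_def tensor_idx_def J0 mat_exp_def mat_series_def spin_idx_half
      spin_dim_half dims
    using block_index_less[OF assms(1,3)] block_index_less[OF assms(2,4)] by simp
  also have "\<dots> = (\<Sum>n. 1 / fact n * (if i = k then (- ?m) ^ n * (?B ^\<^sub>m n) $$ (p, q) else 0))"
  proof -
    have "(- 1 / 2) * ?g k = - ?m"
      by (simp add: field_simps)
    hence "(?A ^\<^sub>m n) $$ (i * Suc N + p, k * Suc N + q) =
        (if i = k then (- ?m) ^ n * (?B ^\<^sub>m n) $$ (p, q) else 0)" for n
      using tensor_diag_pow_index[OF B assms, of "- 1 / 2" ?g n] by metis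
    thus ?thesis by (simp only:)
  qed
  also have "\<dots> = (if i = k then (\<Sum>n. (- ?m) ^ n / fact n * (?B ^\<^sub>m n) $$ (p, q)) else 0)"
    by (cases "i = k") (simp_all del: of_real_diff)
  also have "(\<Sum>n. (- ?m) ^ n / fact n * (?B ^\<^sub>m n) $$ (p, q)) =
      weighted_toeplitz (Suc N) (- 2 * h) (spin_weight N) (fps_binomial ?m) $$ (p, q)"
  proof -
    \<comment> \<open>The powers of - m are absorbed in the coefficients, leaving exp (- m X)
      composed with - ln (1 + X).\<close>
    have "Abs_fps (\<lambda>n. (- ?m) ^ n / fact n) = fps_exp (- ?m)"
      by (simp add: fps_eq_iff)
    thus ?thesis
      using suminf_weighted_toeplitz[of "- fps_ln 1" p "Suc N" q "\<lambda>n. (- ?m) ^ n / fact n"] assms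
      unfolding sigma_eq_weighted_toeplitz
      by (simp only: weighted_toeplitz_power spin_weight_nonzero not_False_eq_True
          fps_exp_compose_neg_ln fps_neg_nth fps_ln_0 minus_zero)
  qed
  finally show ?thesis
    using assms by (simp add: weighted_toeplitz_index)
qed

section \<open>The coefficients S and G\<close>

text \<open>For m = j - i one has j - m = i and j + m = N - i, so the four factorials pair off into
  two weights.\<close>

lemma S_coeff_spin_weight:
  assumes "p \<le> N" "q \<le> N"
  shows "complex_of_real (S_coeff (real N / 2) (real N / 2 - real p) (real N / 2 - real q)) =
    spin_weight N q / spin_weight N p"
proof -
  have "real N / 2 + (real N / 2 - real x) = real (N - x)"
    "real N / 2 - (real N / 2 - real x) = real x" if "x \<le> N" for x
    using that by (simp_all add: of_nat_diff)
  hence "S_coeff (real N / 2) (real N / 2 - real p) (real N / 2 - real q) =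
      sqrt ((fact q * fact (N - p)) / (fact (N - q) * fact p))"
    using assms by (simp add: S_coeff_def del: of_nat_diff)
  also have "\<dots> = sqrt (fact q / fact (N - q)) / sqrt (fact p / fact (N - p))"
    by (simp flip: real_sqrt_divide)
  finally show ?thesis
    by (simp add: spin_weight_def)
qed

text \<open>Each new factor x + 2 n is positive, so the recursion applies. For x = 1 and x = 2 the
  convention gives (x - 2)!! = 1, the right start.\<close>

lemma double_fact_rising:
  assumes "x > 0"
  shows "double_fact (2 * int n + x - 2) = (\<Prod>i<n. x + 2 * int i) * double_fact (x - 2)"
proof (induction n)
  case (Suc n)
  have "double_fact (2 * int (Suc n) + x - 2) = (x + 2 * int n) * double_fact (2 * int n + x - 2)"
    using assms by (subst double_fact.simps) (simp add: algebra_simps)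
  thus ?case by (simp add: Suc)
qed simp

lemma double_fact_pos: "double_fact n > 0"
  by (induction n rule: double_fact.induct) (subst double_fact.simps, auto)

text \<open>A factor 2 comes out of each of the n factors. It is applied with x = - 2 m_1 for m_1 <
  0 and with x = 2 m_1 for m_1 > 0.\<close>

lemma double_fact_quotient:
  assumes "x > 0"
  shows "(of_int (double_fact (2 * int n + x - 2)) / of_int (double_fact (x - 2)) :: complex) =
    2 ^ n * pochhammer (of_int x / 2) n"
proof -
  have "of_int (double_fact (2 * int n + x - 2)) / of_int (double_fact (x - 2)) =
      (\<Prod>i<n. of_int x + 2 * of_nat i :: complex)"
    using double_fact_pos[of "x - 2"] by (simp add: double_fact_rising[OF assms])
  also have "\<dots> = (\<Prod>i<n. 2 * (of_int x / 2 + of_nat i))"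
    by (simp add: algebra_simps)
  finally show ?thesis
    unfolding prod.distrib by (simp add: pochhammer_prod lessThan_atLeast0)
qed

text \<open>Coefficient of X^n in (1 + X)^a = (1 + X)^(2 a) (1 + X)^(- a). For a = m_1 > 0 the
  number 2 a is natural, so the first factor yields ordinary binomial coefficients.\<close>

lemma gbinomial_double_minus:
  fixes a :: "'a :: field_char_0"
  shows "a gchoose n = (\<Sum>l=0..n. (2 * a gchoose (n - l)) * (- a gchoose l))"
proof -
  have "fps_binomial a = fps_binomial (- a) * fps_binomial (2 * a)"
    by (simp flip: fps_binomial_add_mult)
  hence "fps_nth (fps_binomial a) n = fps_nth (fps_binomial (- a) * fps_binomial (2 * a)) n"
    by simp
  thus ?thesis by (simp add: fps_mult_nth mult.commute)
qed

lemma G_coeff_neg: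
  assumes "x > 0" "p \<le> q"
  shows "G_coeff h (real N / 2) (- of_int x / 2) (real N / 2 - real p) (real N / 2 - real q) =
    (- of_int x / 2 gchoose (q - p)) * (- 2 * h) ^ (q - p)"
proof -
  let ?n = "q - p"
  have f: "real N / 2 - real p - (real N / 2 - real q) = real ?n"
    "2 * (real N / 2 - real p) - 2 * (- of_int x / 2) - 2 * (real N / 2 - real q) - 2
      = of_int (2 * int ?n + x - 2)"
    "- 2 * (- of_int x / 2) - 2 = real_of_int (x - 2)"
    using assms by (simp_all add: of_nat_diff algebra_simps)
  have "G_coeff h (real N / 2) (- of_int x / 2) (real N / 2 - real p) (real N / 2 - real q) =
     of_int (double_fact (2 * int ?n + x - 2)) / of_int (double_fact (x - 2)) / fact ?n * h ^ ?n"
    using assms unfolding G_coeff_def f floor_of_int floor_of_nat by (simp del: of_nat_diff)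
  also have "\<dots> = (- of_int x / 2 gchoose ?n) * (- 2 * h) ^ ?n"
  proof -
    \<comment> \<open>The sign (-1)^n cancels the one from the negative upper argument of
      \<open>gchoose\<close>; 2^n matches the double factorials.\<close>
    have "(- 2 * h) ^ ?n = (- 1 * 2 * h) ^ ?n"
      by simp
    also have "\<dots> = (- 1) ^ ?n * 2 ^ ?n * h ^ ?n"
      by (simp only: power_mult_distrib)
    finally show ?thesis
      unfolding double_fact_quotient[OF assms(1)] gbinomial_pochhammer by simp
  qed
  finally show ?thesis .
qed

lemma binom_eq_gbinomial: "binom (int n) (int k) = of_nat n gchoose k"
  by (simp add: binom_def binomial_eq_0 flip: binomial_gbinomial)

lemma G_coeff_pos:
  assumes "x > 0" "p \<le> q"
  shows "G_coeff h (real N / 2) (of_nat x / 2) (real N / 2 - real p) (real N / 2 - real q) =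
    (of_nat x / 2 gchoose (q - p)) * (- 2 * h) ^ (q - p)"
proof -
  let ?n = "q - p"
  have f: "real N / 2 - real p - (real N / 2 - real q) = real ?n"
    "real N / 2 - (real N / 2 - real q) = real q"
    "\<And>l. 2 * real l + real x - 2 = of_int (2 * int l + int x - 2)"
    "real x - 2 = real_of_int (int x - 2)"
    "2 * (of_nat x / 2) = real x"
    using assms by (simp_all add: of_nat_diff)
  let ?t = "\<lambda>l. (- 1) ^ l * binom (int x) (int ?n - int l)
      * of_int (double_fact (2 * int l + int x - 2)) / (2 ^ l * fact l * of_int (double_fact (int x - 2)))"
  have "G_coeff h (real N / 2) (of_nat x / 2) (real N / 2 - real p) (real N / 2 - real q) =
     (- 2 * h) ^ ?n * (\<Sum>l = 0..q. ?t l)"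
    using assms unfolding G_coeff_def f floor_of_int floor_of_nat by (simp del: of_nat_diff)
  \<comment> \<open>The upper limit j_2 - m_2 = q may exceed n; beyond n the lower index of
    \<open>binom\<close> is negative.\<close>
  also have "(\<Sum>l = 0..q. ?t l) = (\<Sum>l = 0..?n. ?t l)"
    by (rule sum.mono_neutral_right) (auto simp: binom_def)
  also have "\<dots> = (\<Sum>l = 0..?n. (2 * (of_nat x / 2) gchoose (?n - l)) * (- (of_nat x / 2) gchoose l))"
  proof (rule sum.cong[OF refl])
    fix l assume "l \<in> {0..?n}"
    hence b: "binom (int x) (int ?n - int l) = of_nat x gchoose (?n - l)"
      using binom_eq_gbinomial[of x "?n - l"] by (simp only: of_nat_diff atLeastAtMost_iff)
    have "?t l = (- 1) ^ l * binom (int x) (int ?n - int l) / (2 ^ l * fact l) *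
        (of_int (double_fact (2 * int l + int x - 2)) / of_int (double_fact (int x - 2)))"
      by simp
    also have "\<dots> = (2 * (of_nat x / 2) gchoose (?n - l)) * (- (of_nat x / 2) gchoose l)"
      unfolding b using assms(1)
      by (subst double_fact_quotient) (simp_all add: gbinomial_pochhammer[of "- _"])
    finally show "?t l = (2 * (of_nat x / 2) gchoose (?n - l)) * (- (of_nat x / 2) gchoose l)" .
  qed
  finally show ?thesis by (simp only: mult.commute gbinomial_double_minus[of "of_nat x / 2" ?n])
qed

text \<open>The sign of m_1 is that of N1 - 2 i. At m_1 = 0 the double factorials give the binomial
  coefficient only for p = q.\<close>

lemma G_coeff_gbinomial:
  assumes "p \<le> q" "i \<le> N1" "2 * i \<noteq> N1 \<or> p = q"
  shows "G_coeff h (real N / 2) (real N1 / 2 - real i) (real N / 2 - real p) (real N / 2 - real q) =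
    (complex_of_real (real N1 / 2 - real i) gchoose (q - p)) * (- 2 * h) ^ (q - p)"
proof -
  consider "2 * i < N1" | "2 * i > N1" | "2 * i = N1" "p = q"
    using assms by linarith
  thus ?thesis
  proof cases
    case 1
    hence eq: "real N1 / 2 - real i = of_nat (N1 - 2 * i) / 2"
      by (simp add: of_nat_diff)
    show ?thesis
      unfolding eq using G_coeff_pos[of "N1 - 2 * i" p q h N] 1 assms by simp
  next
    case 2
    hence eq: "real N1 / 2 - real i = - of_int (2 * int i - int N1) / 2"
      by simp
    show ?thesis
      unfolding eq using G_coeff_neg[of "2 * int i - int N1" p q h N] 2 assms by simp
  next
    case 3
    \<comment> \<open>Both double factorials are (-2)!! = 1 here, and both sides are 1.\<close>
    hence eq: "real N1 / 2 - real i = 0"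
      by (simp flip: 3(1))
    show ?thesis
      unfolding eq using 3(2) double_fact.simps[of "-2"] by (simp add: G_coeff_def)
  qed
qed

section \<open>From half-integer weights to matrix indices\<close>

lemma spins_weightsE:
  assumes "j \<in> spins"
  obtains N where "j = real N / 2" "\<And>m. m \<in> weights j \<Longrightarrow> \<exists>i\<le>N. m = real N / 2 - real i"
proof -
  obtain N where N: "j = real N / 2"
    using assms by (auto simp: spins_def)
  have "\<exists>i\<le>N. m = real N / 2 - real i" if m: "m \<in> weights j" for m
  proof -
    obtain z where z: "j - m = of_int z"
      using m by (auto simp: weights_def elim: Ints_cases)
    have "0 \<le> real_of_int z" "real_of_int z \<le> of_int (int N)"
      using m N by (auto simp: weights_def simp flip: z)
    hence "0 \<le> z" "nat z \<le> N"
      by simp_all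
    thus ?thesis
      using z N by (intro exI[of _ "nat z"]) simp
  qed
  with N that show thesis by blast
qed

theorem mainTheorem9:
  fixes h :: complex and j1 j2 k1 k2 m1 m2 :: real
  assumes "j1 \<in> spins" and "j2 \<in> spins"
    and "k1 \<in> weights j1" and "m1 \<in> weights j1"
    and "k2 \<in> weights j2" and "m2 \<in> weights j2"
  shows "(m1 \<noteq> 0 \<or> k2 \<le> m2 \<longrightarrow>
            twist_elem h j1 j2 k1 k2 m1 m2 =
              (if k1 = m1 then 1 else 0) * theta (m2 \<le> k2 \<and> k2 \<le> j2)
                * complex_of_real (S_coeff j2 k2 m2) * G_coeff h j2 m1 k2 m2)
       \<and> (m1 = 0 \<and> m2 < k2 \<longrightarrow> twist_elem h j1 j2 k1 k2 m1 m2 = 0)"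
proof -
  obtain N1 where N1: "j1 = real N1 / 2" "\<And>m. m \<in> weights j1 \<Longrightarrow> \<exists>i\<le>N1. m = real N1 / 2 - real i"
    using spins_weightsE[OF assms(1)] by blast
  obtain N where N: "j2 = real N / 2" "\<And>m. m \<in> weights j2 \<Longrightarrow> \<exists>i\<le>N. m = real N / 2 - real i"
    using spins_weightsE[OF assms(2)] by blast
  obtain i where i: "i \<le> N1" "k1 = real N1 / 2 - real i" using N1(2)[OF assms(3)] by blast
  obtain k where k: "k \<le> N1" "m1 = real N1 / 2 - real k" using N1(2)[OF assms(4)] by blast
  obtain p where p: "p \<le> N" "k2 = real N / 2 - real p" using N(2)[OF assms(5)] by blast
  obtain q where q: "q \<le> N" "m2 = real N / 2 - real q" using N(2)[OF assms(6)] by blast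
  \<comment> \<open>This form holds for every m_1, zero included; both claims are read off from
    it.\<close>
  have elem: "twist_elem h j1 j2 k1 k2 m1 m2 =
    (if k1 = m1 \<and> m2 \<le> k2 then (complex_of_real m1 gchoose (q - p)) *
       (- 2 * h) ^ (q - p) * complex_of_real (S_coeff j2 k2 m2) else 0)"
  proof -
    \<comment> \<open>Indices run opposite to weights, which reverses the inequality.\<close>
    have "k1 = m1 \<longleftrightarrow> i = k" "m2 \<le> k2 \<longleftrightarrow> p \<le> q"
      using i k p q by simp_all
    moreover have "i < Suc N1" "k < Suc N1" "p < Suc N" "q < Suc N"
      using i k p q by simp_all
    ultimately show ?thesis
      unfolding N1(1) N(1) i(2) k(2) p(2) q(2) S_coeff_spin_weight[OF p(1) q(1)]
      by (simp only: twist_elem_gbinomial times_divide_eq_right)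
  qed
  have zero: "twist_elem h j1 j2 k1 k2 m1 m2 = 0" if "m1 = 0" "m2 < k2"
  proof -
    \<comment> \<open>The series (1 + X)^0 = 1 has no coefficient of positive degree.\<close>
    have "q - p > 0" using that p q by simp
    then obtain n where "q - p = Suc n" using gr0_conv_Suc by blast
    thus ?thesis using that elem by simp
  qed
  have "twist_elem h j1 j2 k1 k2 m1 m2 = (if k1 = m1 then 1 else 0) * theta (m2 \<le> k2 \<and> k2 \<le> j2)
      * complex_of_real (S_coeff j2 k2 m2) * G_coeff h j2 m1 k2 m2" if "m1 \<noteq> 0 \<or> k2 \<le> m2"
  proof (cases "m2 \<le> k2")
    case True
    hence "p \<le> q" "2 * k \<noteq> N1 \<or> p = q"
      using that k p q by auto
    hence "G_coeff h j2 m1 k2 m2 = (complex_of_real m1 gchoose (q - p)) * (- 2 * h) ^ (q - p)"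
      unfolding N(1) k(2) p(2) q(2) using G_coeff_gbinomial k(1) by blast
    moreover have "k2 \<le> j2"
      using p(2) N(1) by simp
    ultimately show ?thesis
      using True unfolding elem by (simp add: theta_def)
  qed (simp add: elem theta_def)
  with zero show ?thesis by blast
qed

end
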